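(* Let $g:\mathbb{R}^n\times\Delta\to\mathbb{R}^r$, with $\Delta\subseteq\mathbb{R}^d$, be of the form $$g(x,\delta) = G(x)\,\delta + H(x),$$ where $G:\mathbb{R}^n\to\mathbb{R}^{r\times d}$ and $H:\mathbb{R}^n\to\mathbb{R}^r$, and suppose the standing regularity assumption (see context) holds. Then the scenario program $\mathrm{SP}[\omega]$ with constraint function $g$ satisfies $|\mathrm{sc}(\mathrm{SP}[\omega])| \le r(d+1)$ almost surely.
   Context: Setting. $(\Delta,\mathcal{F},\mathbb{P})$ is a probability space with $\Delta\subseteq\mathbb{R}^d$; $\mathcal{X}\subset\mathbb{R}^n$ is a compact convex set; $c\in\mathbb{R}^n$. Vector inequalities are understood element-wise. Given a multi-sample $\omega=\{\delta^{(1)},\ldots,\delta^{(N)}\}\in\Delta^N$ of i.i.d. samples drawn according to $\mathbb{P}$, the scenario program is $$\mathrm{SP}[\omega]:\quad \min_{x\in\mathcal{X}} c^\top x \quad\text{s.t.}\quad g(x,\delta^{(j)})\le 0\ \ \forall j\in\{1,\ldots,N\}.$$ Standing regularity assumption. For almost all $\delta\in\Delta$, the function $x\mapsto g(x,\delta)$ is convex and lower semi-continuous (componentwise). For any integer $N$, $\mathrm{SP}[\omega]$ is almost surely feasible, and its optimizer exists and is unique for almost all $\omega\in\Delta^N$. For all $x\in\mathcal{X}$, the mapping $\delta\mapsto g(x,\delta)$ is measurable. Support constraints. Let $x^\star$ be the minimizer of $\mathrm{SP}[\omega]$ and, for $k\in\{1,\ldots,N\}$, let $x_k^\star$ be the minimizer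 of $\mathrm{SP}[\omega\setminus\{\delta^{(k)}\}]$ (the program with the $k$-th sample removed). The sample $\delta^{(k)}$ is a support sample, and $g(\cdot,\delta^{(k)})\le 0$ a support constraint, if $c^\top x_k^\star<c^\top x^\star$. $\mathrm{sc}(\mathrm{SP}[\omega])$ is the set of support constraints and $|\mathrm{sc}(\mathrm{SP}[\omega])|$ its cardinality (the number of such indices $k$). "Almost surely" refers to the product measure $\mathbb{P}^N$ on $\Delta^N$, for any number $N$ of samples. *)

theory Defs
  imports "HOL-Probability.Probability"
begin

definition lower_semicontinuous :: "('a::topological_space \<Rightarrow> real) \<Rightarrow> bool" where
  "lower_semicontinuous f \<longleftrightarrow> (\<forall>x. \<forall>a < f x. eventually (\<lambda>y. a < f y) (nhds x))"

text \<open>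
  A multi-sample is an indexed family \<open>\<omega>\<close>, so that repeated values are kept apart; the scenario
  program uses the samples with index in \<open>J\<close>, and removing the \<open>k\<close>-th sample means removing \<open>k\<close>
  from \<open>J\<close>. The order on \<open>real ^ 'r\<close> is the element-wise one.
\<close>

definition feasible_set ::
  "(real ^ 'n) set \<Rightarrow> (real ^ 'n \<Rightarrow> 'd \<Rightarrow> real ^ 'r) \<Rightarrow> nat set \<Rightarrow> (nat \<Rightarrow> 'd) \<Rightarrow> (real ^ 'n) set"
  where "feasible_set X g J \<omega> = {x \<in> X. \<forall>j\<in>J. g x (\<omega> j) \<le> 0}"

definition is_minimizer ::
  "(real ^ 'n) set \<Rightarrow> real ^ 'n \<Rightarrow> (real ^ 'n \<Rightarrow> 'd \<Rightarrow> real ^ 'r) \<Rightarrow> nat set \<Rightarrow> (nat \<Rightarrow> 'd)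
     \<Rightarrow> real ^ 'n \<Rightarrow> bool"
  where "is_minimizer X c g J \<omega> = is_arg_min (\<lambda>x. c \<bullet> x) (\<lambda>x. x \<in> feasible_set X g J \<omega>)"

text \<open>
  The minimizer is an arbitrary one if there are several, and unspecified if there is none.
\<close>

definition minimizer ::
  "(real ^ 'n) set \<Rightarrow> real ^ 'n \<Rightarrow> (real ^ 'n \<Rightarrow> 'd \<Rightarrow> real ^ 'r) \<Rightarrow> nat set \<Rightarrow> (nat \<Rightarrow> 'd)
     \<Rightarrow> real ^ 'n"
  where "minimizer X c g J \<omega> = arg_min_on (\<lambda>x. c \<bullet> x) (feasible_set X g J \<omega>)"

text \<open>Support constraints are identified with the indices of their samples.\<close>

definition support_constraints ::
  "(real ^ 'n) set \<Rightarrow> real ^ 'n \<Rightarrow> (real ^ 'n \<Rightarrow> 'd \<Rightarrow> real ^ 'r) \<Rightarrow> nat \<Rightarrow> (nat \<Rightarrow> 'd) \<Rightarrow> nat set"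
  where "support_constraints X c g N \<omega> =
    {k \<in> {1..N}. c \<bullet> minimizer X c g ({1..N} - {k}) \<omega> < c \<bullet> minimizer X c g {1..N} \<omega>}"

end

theory Submission
  imports Defs
begin

text \<open>
  If there are support samples \<open>K\<close>, the minimizers \<open>x\<^sub>k\<close> of the reduced programs span a convex set on
  which the objective is below the optimum, hence which contains no feasible point, although each
  \<open>x\<^sub>k\<close> violates sample \<open>k\<close> only. So the claim is a Helly-type bound. Split the samples into their scalar
  rows and take a minimal infeasible family of scalar constraints: it still involves every sample of
  \<open>K\<close>, and each of its members \<open>(i, k)\<close> has a witness that violates only this member. If one row \<open>i\<close>
  contributed more than \<open>d + 1\<close> members, the vectors \<open>(G\<^sub>i(y), H\<^sub>i(y))\<close> at the witnesses \<open>y\<close> of these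
  members would be linearly dependent, and the positive part of the dependency would give the weights
  of a convex combination of witnesses that satisfies the whole family.
\<close>

section \<open>Linear dependence and the Helly-type bound\<close>

text \<open>The matrix \<open>a k \<bullet> F (y j)\<close> is nonpositive off the diagonal. A
  dependency among the vectors \<open>F (y j)\<close> balances its positive part against its
  negative part, whose supports are disjoint; so each \<open>k\<close> can be tested against the
  part that avoids it, where only off-diagonal entries occur. Convexity then passes from the
  weighted average to the point \<open>z\<close>.\<close>

lemma convex_combination_inner_le_0:
  fixes F :: "'x::real_vector \<Rightarrow> 'v::euclidean_space" and a :: "'k \<Rightarrow> 'v" and y :: "'k \<Rightarrow> 'x"
  assumes fin: "finite S" and large: "card S > DIM('v)"
    and C: "convex C" "\<And>j. j \<in> S \<Longrightarrow> y j \<in> C"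
    and conv: "\<And>k. k \<in> S \<Longrightarrow> convex_on C (\<lambda>x. a k \<bullet> F x)"
    and off_diag: "\<And>j k. j \<in> S \<Longrightarrow> k \<in> S \<Longrightarrow> j \<noteq> k \<Longrightarrow> a k \<bullet> F (y j) \<le> 0"
  shows "\<exists>z \<in> convex hull (y ` S). \<forall>k\<in>S. a k \<bullet> F z \<le> 0"
proof (cases "\<exists>j\<in>S. a j \<bullet> F (y j) \<le> 0")
  case True
  then obtain j where j: "j \<in> S" "a j \<bullet> F (y j) \<le> 0" by blast
  with off_diag have "\<forall>k\<in>S. a k \<bullet> F (y j) \<le> 0" by metis
  moreover have "y j \<in> convex hull (y ` S)" using j by (simp add: hull_inc)
  ultimately show ?thesis by blast
next
  case False
  then have diag: "a j \<bullet> F (y j) > 0" if "j \<in> S" for j using that by force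
  \<comment> \<open>Linear dependence is a property of sets, so the image must keep the cardinality
    of \<open>S\<close>: \<open>a j\<close> is positive at \<open>F (y j)\<close> but not at any
    other \<open>F (y k)\<close>.\<close>
  have inj: "inj_on (\<lambda>j. F (y j)) S"
  proof (rule inj_onI, rule ccontr)
    fix j k assume "j \<in> S" "k \<in> S" "F (y j) = F (y k)" "j \<noteq> k"
    then show False using diag[of j] off_diag[of k j] by simp
  qed
  then have "dependent ((\<lambda>j. F (y j)) ` S)"
    using fin large by (intro dependent_biggerset) (simp add: card_image)
  then obtain u p where u: "p \<in> S" "u (F (y p)) \<noteq> 0" "(\<Sum>v\<in>(\<lambda>j. F (y j)) ` S. u v *\<^sub>R v) = 0"
    using fin by (auto simp: dependent_finite)
  \<comment> \<open>The sign is chosen so that the coefficient at \<open>p\<close> is positive; this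
    makes the total weight \<open>W\<close> of the positive part nonzero.\<close>
  define v where "v j = (if u (F (y p)) > 0 then u (F (y j)) else - u (F (y j)))" for j
  have vp: "v p > 0" using u(2) by (auto simp: v_def)
  have "(\<Sum>j\<in>S. u (F (y j)) *\<^sub>R F (y j)) = 0"
    using u(3) inj by (simp add: sum.reindex)
  then have v0: "(\<Sum>j\<in>S. v j *\<^sub>R F (y j)) = 0"
    by (cases "u (F (y p)) > 0") (simp_all add: v_def sum_negf)
  define w where "w j = max (v j) 0" for j
  define W where "W = sum w S"
  have w_nonneg: "w j \<ge> 0" for j by (simp add: w_def)
  have "w p > 0" using vp by (simp add: w_def)
  then have W: "W > 0"
    unfolding W_def using fin u(1) w_nonneg by (intro sum_pos2) auto
  have weighted: "(\<Sum>j\<in>S. w j * (a k \<bullet> F (y j))) \<le> 0" if k: "k \<in> S" for k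
  proof (cases "v k > 0")
    case False
    then have "w k = 0" by (simp add: w_def)
    have "w j * (a k \<bullet> F (y j)) \<le> 0" if "j \<in> S" for j
      using \<open>w k = 0\<close> off_diag[OF that k] w_nonneg[of j]
      by (cases "j = k") (simp_all add: mult_nonneg_nonpos)
    then show ?thesis by (intro sum_nonpos)
  next
    case True
    have "(\<Sum>j\<in>S. v j * (a k \<bullet> F (y j))) = a k \<bullet> (\<Sum>j\<in>S. v j *\<^sub>R F (y j))"
      by (simp add: inner_sum_right)
    \<comment> \<open>Subtracting the vanishing sum leaves the weights \<open>w j - v j\<close>, the
      negative part of \<open>v\<close>, which is zero at \<open>k\<close> because
      \<open>v k > 0\<close>.\<close>
    then have "(\<Sum>j\<in>S. w j * (a k \<bullet> F (y j))) = (\<Sum>j\<in>S. (w j - v j) * (a k \<bullet> F (y j)))"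
      by (simp add: v0 left_diff_distrib sum_subtractf)
    also have "\<dots> \<le> 0"
    proof (intro sum_nonpos)
      fix j assume j: "j \<in> S"
      show "(w j - v j) * (a k \<bullet> F (y j)) \<le> 0"
      proof (cases "j = k")
        case True
        with \<open>v k > 0\<close> show ?thesis by (simp add: w_def)
      next
        case False
        with off_diag j k show ?thesis by (intro mult_nonneg_nonpos) (auto simp: w_def)
      qed
    qed
    finally show ?thesis .
  qed
  define z where "z = (\<Sum>j\<in>S. (w j / W) *\<^sub>R y j)"
  have sum1: "(\<Sum>j\<in>S. w j / W) = 1"
    using W by (simp add: W_def flip: sum_divide_distrib)
  have "z \<in> convex hull (y ` S)"
    unfolding z_def using fin sum1 W w_nonneg
    by (intro convex_sum) (auto simp: hull_inc)
  moreover have "a k \<bullet> F z \<le> 0" if k: "k \<in> S" for k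
  proof -
    have "a k \<bullet> F z \<le> (\<Sum>j\<in>S. w j / W * (a k \<bullet> F (y j)))"
      unfolding z_def using fin u(1) conv[OF k] sum1 W w_nonneg C(2)
      by (intro convex_on_sum) auto
    also have "\<dots> = (\<Sum>j\<in>S. w j * (a k \<bullet> F (y j))) / W"
      by (simp add: sum_divide_distrib)
    also have "\<dots> \<le> 0" using weighted[OF k] W by (simp add: divide_nonpos_pos)
    finally show ?thesis .
  qed
  ultimately show ?thesis by blast
qed

lemma convex_on_sublevel:
  fixes f :: "'x::real_vector \<Rightarrow> real"
  assumes "convex_on C f"
  shows "convex {x \<in> C. f x \<le> b}"
proof (rule convexI)
  fix x y and u v :: real
  assume xy: "x \<in> {x \<in> C. f x \<le> b}" "y \<in> {x \<in> C. f x \<le> b}"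
    and uv: "0 \<le> u" "0 \<le> v" "u + v = 1"
  have "f (u *\<^sub>R x + v *\<^sub>R y) \<le> u * f x + v * f y"
    using assms xy uv by (auto simp: convex_on_def)
  also have "\<dots> \<le> b"
    using xy uv by (intro convex_bound_le) auto
  finally show "u *\<^sub>R x + v *\<^sub>R y \<in> {x \<in> C. f x \<le> b}"
    using assms xy uv by (auto simp: convex_on_def convex_def)
qed

text \<open>A witness for a sample may violate several of its rows. Minimality over pairs of row and
  sample gives each pair its own witness, so that the dimension bound applies to each row
  separately.\<close>

lemma card_le_if_minimally_infeasible:
  fixes F :: "'r::finite \<Rightarrow> 'x::real_vector \<Rightarrow> 'v::euclidean_space" and a :: "'k \<Rightarrow> 'v"
  assumes fin: "finite K" and C: "convex C"
    and conv: "\<And>i k. k \<in> K \<Longrightarrow> convex_on C (\<lambda>x. a k \<bullet> F i x)"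
    and infeasible: "\<not> (\<exists>x\<in>C. \<forall>k\<in>K. \<forall>i. a k \<bullet> F i x \<le> 0)"
    and witness: "\<And>k. k \<in> K \<Longrightarrow> \<exists>x\<in>C. \<forall>j\<in>K - {k}. \<forall>i. a j \<bullet> F i x \<le> 0"
  shows "card K \<le> CARD('r) * DIM('v)"
proof -
  define feas where "feas T x \<longleftrightarrow> x \<in> C \<and> (\<forall>(i, k)\<in>T. a k \<bullet> F i x \<le> 0)" for T x
  define \<T> where "\<T> = {T. T \<subseteq> UNIV \<times> K \<and> \<not> (\<exists>x. feas T x)}"
  have "finite \<T>"
    unfolding \<T>_def using fin by (auto intro: finite_subset[of _ "Pow (UNIV \<times> K)"])
  moreover have "UNIV \<times> K \<in> \<T>"
    using infeasible by (auto simp: \<T>_def feas_def, meson)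
  ultimately obtain T where T: "T \<in> \<T>" and T_min: "\<And>U. U \<in> \<T> \<Longrightarrow> U \<subseteq> T \<Longrightarrow> T = U"
    using finite_has_minimal[of \<T>] by auto
  have T_sub: "T \<subseteq> UNIV \<times> K" and T_inf: "\<And>x. \<not> feas T x"
    using T by (auto simp: \<T>_def)
  have minimal: "\<exists>x. feas (T - {p}) x" if "p \<in> T" for p
  proof -
    have "T - {p} \<notin> \<T>" using T_min[of "T - {p}"] that by auto
    then show ?thesis using T_sub by (auto simp: \<T>_def)
  qed
  have finT: "finite T" using T_sub fin by (auto intro: finite_subset)
  \<comment> \<open>The witness for \<open>k\<close> satisfies every other sample, so whichever
    member of \<open>T\<close> it violates must belong to \<open>k\<close>.\<close>
  have "K \<subseteq> snd ` T"
  proof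
    fix k assume k: "k \<in> K"
    obtain x where x: "x \<in> C" "\<And>j i. j \<in> K - {k} \<Longrightarrow> a j \<bullet> F i x \<le> 0"
      using witness[OF k] by blast
    obtain i l where "(i, l) \<in> T" "\<not> a l \<bullet> F i x \<le> 0"
      using T_inf[of x] x(1) by (auto simp: feas_def)
    with x(2)[of l i] T_sub have "(i, k) \<in> T" by auto
    then show "k \<in> snd ` T" by force
  qed
  then have "card K \<le> card T" by (meson card_image_le card_mono finT finite_imageI order_trans)
  also have "card T = card (SIGMA i:UNIV. T `` {i})"
    by (rule arg_cong[where f = card]) auto
  also have "\<dots> = (\<Sum>i\<in>UNIV. card (T `` {i}))"
    using finT by (intro card_SigmaI) auto
  also have "\<dots> \<le> (\<Sum>i\<in>(UNIV :: 'r set). DIM('v))"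
  proof (intro sum_mono, rule ccontr)
    fix i :: 'r
    let ?S = "T `` {i}"
    assume "\<not> card ?S \<le> DIM('v)"
    then have large: "card ?S > DIM('v)" by simp
    have "\<forall>k. \<exists>x. k \<in> ?S \<longrightarrow> feas (T - {(i, k)}) x" using minimal by blast
    then obtain y where y: "\<And>k. k \<in> ?S \<Longrightarrow> feas (T - {(i, k)}) (y k)" by metis
    have S_sub: "?S \<subseteq> K" using T_sub by auto
    have "\<exists>z \<in> convex hull (y ` ?S). \<forall>k\<in>?S. a k \<bullet> F i z \<le> 0"
    proof (rule convex_combination_inner_le_0[OF _ large C])
      show "finite ?S" using finT by simp
      show "y j \<in> C" if "j \<in> ?S" for j using y[OF that] by (simp add: feas_def)
      show "convex_on C (\<lambda>x. a k \<bullet> F i x)" if "k \<in> ?S" for k using conv S_sub that by blast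
      show "a k \<bullet> F i (y j) \<le> 0" if "j \<in> ?S" "k \<in> ?S" "j \<noteq> k" for j k
        using y[OF that(1)] that by (auto simp: feas_def)
    qed
    then obtain z where z: "z \<in> convex hull (y ` ?S)" "\<And>k. k \<in> ?S \<Longrightarrow> a k \<bullet> F i z \<le> 0"
      by blast
    \<comment> \<open>On the other rows every \<open>y j\<close> already satisfies all of
      \<open>T\<close>, as only a member of row \<open>i\<close> was dropped, and convex sublevel
      sets pass this on to \<open>z\<close>.\<close>
    have "a k \<bullet> F l z \<le> 0" if lk: "(l, k) \<in> T" for l k
    proof (cases "l = i")
      case True
      with z(2) lk show ?thesis by blast
    next
      case False
      have "convex {x \<in> C. a k \<bullet> F l x \<le> 0}"
        using conv lk T_sub by (intro convex_on_sublevel) auto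
      moreover have "y ` ?S \<subseteq> {x \<in> C. a k \<bullet> F l x \<le> 0}"
        using y lk False by (auto simp: feas_def)
      ultimately show ?thesis using z(1) hull_minimal by blast
    qed
    moreover have "z \<in> C"
      using z(1) hull_minimal[of "y ` ?S" C convex] C y by (auto simp: feas_def)
    ultimately have "feas T z" by (auto simp: feas_def)
    then show False using T_inf by blast
  qed
  also have "\<dots> = CARD('r) * DIM('v)" by simp
  finally show ?thesis .
qed

section \<open>Attained minima and the bound for a fixed multi-sample\<close>

lemma closed_sublevel_lower_semicontinuous:
  assumes "lower_semicontinuous f"
  shows "closed {x. f x \<le> a}"
proof -
  have "open {x. a < f x}"
  proof (subst open_subopen, intro ballI)
    fix x assume "x \<in> {x. a < f x}"
    then have "eventually (\<lambda>y. a < f y) (nhds x)"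
      using assms by (simp add: lower_semicontinuous_def)
    then show "\<exists>T. open T \<and> x \<in> T \<and> T \<subseteq> {x. a < f x}"
      unfolding eventually_nhds by blast
  qed
  then show ?thesis by (simp add: closed_def Compl_eq not_le)
qed

lemma feasible_set_eq:
  "feasible_set X g J \<omega> = X \<inter> (\<Inter>j\<in>J. \<Inter>i. {x. g x (\<omega> j) $ i \<le> 0})"
  by (auto simp: feasible_set_def less_eq_vec_def)

text \<open>\<open>minimizer\<close> is a choice and means something only if the minimum is
  attained; here the feasible set is closed in the compact \<open>X\<close>.\<close>

lemma is_minimizer_minimizer:
  assumes "compact X" "feasible_set X g J \<omega> \<noteq> {}"
    and "\<And>j i. j \<in> J \<Longrightarrow> lower_semicontinuous (\<lambda>x. g x (\<omega> j) $ i)"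
  shows "is_minimizer X c g J \<omega> (minimizer X c g J \<omega>)"
proof -
  have "compact (feasible_set X g J \<omega>)"
    unfolding feasible_set_eq
    by (intro compact_Int_closed assms closed_INT ballI closed_sublevel_lower_semicontinuous)
  then obtain x where "x \<in> feasible_set X g J \<omega>" "\<forall>y\<in>feasible_set X g J \<omega>. c \<bullet> x \<le> c \<bullet> y"
    using continuous_attains_inf[of "feasible_set X g J \<omega>" "\<lambda>x. c \<bullet> x"] assms(2)
    by (auto simp: continuous_on_inner)
  then have "is_arg_min (\<lambda>x. c \<bullet> x) (\<lambda>x. x \<in> feasible_set X g J \<omega>) x"
    by (simp add: is_arg_min_linorder)
  then show ?thesis
    unfolding is_minimizer_def minimizer_def arg_min_on_def arg_min_def by (rule someI)
qed

lemma card_support_constraints_le: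
  fixes X :: "(real ^ 'n) set"
    and g :: "real ^ 'n \<Rightarrow> real ^ 'd \<Rightarrow> real ^ 'r"
    and G :: "real ^ 'n \<Rightarrow> real ^ 'd ^ 'r"
  assumes X: "compact X" "convex X"
    and g: "\<And>x j. j \<in> {1..N} \<Longrightarrow> g x (\<omega> j) = G x *v \<omega> j + H x"
    and conv: "\<And>j i. j \<in> {1..N} \<Longrightarrow> convex_on UNIV (\<lambda>x. g x (\<omega> j) $ i)"
    and lsc: "\<And>j i. j \<in> {1..N} \<Longrightarrow> lower_semicontinuous (\<lambda>x. g x (\<omega> j) $ i)"
    and feasible: "feasible_set X g {1..N} \<omega> \<noteq> {}"
  shows "card (support_constraints X c g N \<omega>) \<le> CARD('r) * (CARD('d) + 1)"
proof -
  define K where "K = support_constraints X c g N \<omega>"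
  define x where "x k = minimizer X c g ({1..N} - {k}) \<omega>" for k
  define x0 where "x0 = minimizer X c g {1..N} \<omega>"
  have K: "k \<in> {1..N}" "c \<bullet> x k < c \<bullet> x0" if "k \<in> K" for k
    using that by (simp_all add: K_def support_constraints_def x_def x0_def)
  have x: "x k \<in> feasible_set X g ({1..N} - {k}) \<omega>" for k
  proof -
    have "feasible_set X g ({1..N} - {k}) \<omega> \<noteq> {}"
      using feasible by (auto simp: feasible_set_def)
    then show ?thesis
      using is_minimizer_minimizer[of X g "{1..N} - {k}" \<omega> c] X(1) lsc
      by (simp add: x_def is_minimizer_def is_arg_min_def)
  qed
  have x0: "c \<bullet> x0 \<le> c \<bullet> z" if "z \<in> feasible_set X g {1..N} \<omega>" for z
    using is_minimizer_minimizer[of X g "{1..N}" \<omega> c] X(1) lsc feasible that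
    by (simp add: x0_def is_minimizer_def is_arg_min_linorder)
  \<comment> \<open>The samples outside \<open>K\<close> and the strict improvement of the objective
    are absorbed into the convex domain, so that only the samples in \<open>K\<close> remain as
    constraints.\<close>
  define C where "C = {z \<in> feasible_set X g ({1..N} - K) \<omega>. c \<bullet> z < c \<bullet> x0}"
  \<comment> \<open>Appending the coordinate 1 turns a constraint affine in the sample into a linear
    one; this is the source of \<open>d + 1\<close>.\<close>
  define a where "a k = (\<omega> k, 1 :: real)" for k
  define F where "F i z = (G z $ i, H z $ i)" for i z
  have aF: "a k \<bullet> F i z = g z (\<omega> k) $ i" if "k \<in> {1..N}" for k i z
    using that g by (simp add: a_def F_def matrix_vector_mul_component inner_commute)
  have "convex C"
  proof -
    have "convex {z. g z (\<omega> j) $ i \<le> 0}" if "j \<in> {1..N}" for i j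
      using convex_on_sublevel[OF conv[OF that]] by simp
    then have "convex (feasible_set X g ({1..N} - K) \<omega>)"
      unfolding feasible_set_eq using X(2) by (intro convex_Int convex_INT) auto
    moreover have "C = feasible_set X g ({1..N} - K) \<omega> \<inter> {z. c \<bullet> z < c \<bullet> x0}"
      by (auto simp: C_def)
    ultimately show ?thesis by (simp add: convex_Int convex_halfspace_lt)
  qed
  moreover have "finite K" using K(1) by (meson finite_atLeastAtMost finite_subset subsetI)
  moreover have "convex_on C (\<lambda>z. a k \<bullet> F i z)" if "k \<in> K" for i k
    using aF[OF K(1)[OF that]] conv[OF K(1)[OF that]] \<open>convex C\<close>
    by (simp add: convex_on_subset[OF _ subset_UNIV])
  moreover have "\<not> (\<exists>z\<in>C. \<forall>k\<in>K. \<forall>i. a k \<bullet> F i z \<le> 0)"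
  proof
    assume "\<exists>z\<in>C. \<forall>k\<in>K. \<forall>i. a k \<bullet> F i z \<le> 0"
    then obtain z where z: "z \<in> C" "\<And>k i. k \<in> K \<Longrightarrow> a k \<bullet> F i z \<le> 0" by blast
    have "g z (\<omega> j) $ i \<le> 0" if "j \<in> {1..N}" for j i
      using z(1) z(2)[of j i] aF[OF that, of i z] that by (cases "j \<in> K") (auto simp: C_def feasible_set_eq)
    then have "z \<in> feasible_set X g {1..N} \<omega>"
      using z(1) by (auto simp: C_def feasible_set_eq)
    then show False using x0[of z] z(1) by (simp add: C_def)
  qed
  moreover have "\<exists>z\<in>C. \<forall>j\<in>K - {k}. \<forall>i. a j \<bullet> F i z \<le> 0" if k: "k \<in> K" for k
  proof
    show "x k \<in> C" using x[of k] K(2)[OF k] k by (auto simp: C_def feasible_set_def)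
    show "\<forall>j\<in>K - {k}. \<forall>i. a j \<bullet> F i (x k) \<le> 0"
    proof (intro ballI allI)
      fix j i assume j: "j \<in> K - {k}"
      then have "j \<in> {1..N}" using K(1) by blast
      with x[of k] aF[of j i "x k"] j show "a j \<bullet> F i (x k) \<le> 0"
        by (simp add: feasible_set_eq)
    qed
  qed
  ultimately have "card K \<le> CARD('r) * DIM((real ^ 'd) \<times> real)"
    by (intro card_le_if_minimally_infeasible)
  then show ?thesis by (simp add: K_def)
qed

theorem proposition3:
  fixes P :: "(real ^ 'd) measure"
    and X :: "(real ^ 'n) set"
    and c :: "real ^ 'n"
    and g :: "real ^ 'n \<Rightarrow> real ^ 'd \<Rightarrow> real ^ 'r"
    and G :: "real ^ 'n \<Rightarrow> real ^ 'd ^ 'r"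
    and H :: "real ^ 'n \<Rightarrow> real ^ 'r"
    and N :: nat
  assumes "prob_space P"
    and "compact X" and "convex X"
    and "\<And>x \<delta>. \<delta> \<in> space P \<Longrightarrow> g x \<delta> = G x *v \<delta> + H x"
    and "AE \<delta> in P. \<forall>i. convex_on UNIV (\<lambda>x. g x \<delta> $ i) \<and> lower_semicontinuous (\<lambda>x. g x \<delta> $ i)"
    and "\<And>M::nat. M \<ge> 1 \<Longrightarrow> AE \<omega> in (\<Pi>\<^sub>M j\<in>{1..M}. P). feasible_set X g {1..M} \<omega> \<noteq> {}"
    and "\<And>M::nat. M \<ge> 1 \<Longrightarrow> AE \<omega> in (\<Pi>\<^sub>M j\<in>{1..M}. P). \<exists>!x. is_minimizer X c g {1..M} \<omega> x"
    and "\<And>x. x \<in> X \<Longrightarrow> g x \<in> borel_measurable P"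
  shows "AE \<omega> in (\<Pi>\<^sub>M j\<in>{1..N}. P).
           card (support_constraints X c g N \<omega>) \<le> CARD('r) * (CARD('d) + 1)"
proof (cases "N = 0")
  \<comment> \<open>Without samples there are no support constraints; almost sure feasibility is
    assumed only for at least one sample.\<close>
  case True
  then show ?thesis by (simp add: support_constraints_def)
next
  case False
  \<comment> \<open>Each coordinate of the product has law \<open>P\<close>, and finitely many null
    sets are discarded.\<close>
  have "AE \<omega> in (\<Pi>\<^sub>M j\<in>{1..N}. P). \<forall>j\<in>{1..N}. \<forall>i.
      convex_on UNIV (\<lambda>x. g x (\<omega> j) $ i) \<and> lower_semicontinuous (\<lambda>x. g x (\<omega> j) $ i)"
    using assms(5) by (intro AE_finite_allI AE_PiM_component[where M = "\<lambda>_. P"] assms(1)) auto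
  moreover have "AE \<omega> in (\<Pi>\<^sub>M j\<in>{1..N}. P). feasible_set X g {1..N} \<omega> \<noteq> {}"
    using False by (intro assms(6)) simp
  \<comment> \<open>The affine form of \<open>g\<close> is available only for samples in
    \<open>space P\<close>.\<close>
  moreover have "AE \<omega> in (\<Pi>\<^sub>M j\<in>{1..N}. P). \<forall>j\<in>{1..N}. \<omega> j \<in> space P"
    by (rule AE_I2) (auto simp: space_PiM)
  ultimately show ?thesis
  proof eventually_elim
    case (elim \<omega>)
    show ?case
    proof (rule card_support_constraints_le[OF assms(2,3), where G = G and H = H])
      show "g x (\<omega> j) = G x *v \<omega> j + H x" if "j \<in> {1..N}" for x j
        using elim(3) that by (simp add: assms(4))
    qed (use elim in auto)
  qed
qed

end
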